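(* Let $N\ge2$ and let $u$ be a polynomial of degree at most $N+1$. Take either all upper or all lower signs throughout. Let $x_1<\dots<x_N$ be the roots of $T_N\pm T_{N-1}$, and let $u_N$ be the polynomial of degree at most $N$ with $u_N(-1)=u(-1)$ and $u_N'(x_k)=u'(x_k)$ for $k=1,\dots,N$. Then there is a constant $c$ such that for all $x$ $$(u-u_N)(x)= c\Big[\frac{N(x \pm 1)}{N^2-1} (T_N \mp T_{N-1})(x) \pm \frac{N(x^2-1)}{(N^2-1)(N-1)} U_{N-2}(x)- \frac{xT_N(x) + (-1)^N}{N^2-1} \mp \frac{N^2(xT_{N-1}(x) + (-1)^{N-1})}{(N^2-1)(N-1)^2}\pm \frac{2N-1}{(N^2-1)(N-1)^2} \int_{-1}^x T_{N-1}(t)\, dt\Big].$$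
   Context: $T_n$ and $U_n$ are the Chebyshev polynomials of the first and second kind: $T_n(\cos\theta)=\cos n\theta$, $U_n(\cos\theta)=\sin((n+1)\theta)/\sin\theta$. *)

theory Defs
  imports "HOL-Analysis.Analysis" "HOL-Computational_Algebra.Polynomial"
begin

definition Cheb_T :: "nat \<Rightarrow> real poly" where
  "Cheb_T n = (THE p. \<forall>\<theta>. poly p (cos \<theta>) = cos (real n * \<theta>))"

definition Cheb_U :: "nat \<Rightarrow> real poly" where
  "Cheb_U n = (THE p. \<forall>\<theta>. sin \<theta> \<noteq> 0 \<longrightarrow>
     poly p (cos \<theta>) = sin ((real n + 1) * \<theta>) / sin \<theta>)"

text \<open>Both polynomials exist and are unique, so the descriptions above are meaningful.\<close>

lemma poly_eqI_cos:
  fixes p q :: "real poly"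
  assumes "\<And>\<theta>. sin \<theta> \<noteq> 0 \<Longrightarrow> poly p (cos \<theta>) = poly q (cos \<theta>)"
  shows "p = q"
proof (rule ccontr)
  assume "p \<noteq> q"
  then have "finite {t. poly (p - q) t = 0}"
    by (intro poly_roots_finite) simp
  moreover have "{-1<..<1::real} \<subseteq> {t. poly (p - q) t = 0}"
  proof
    fix t :: real
    assume t: "t \<in> {-1<..<1}"
    then have "t\<^sup>2 < 1"
      by (auto simp: abs_square_less_1)
    with t have "sin (arccos t) \<noteq> 0"
      by (simp add: sin_arccos)
    from assms[OF this] t show "t \<in> {t. poly (p - q) t = 0}"
      by simp
  qed
  ultimately have "finite {-1<..<1::real}"
    by (rule rev_finite_subset)
  then show False
    using infinite_Ioo[of "-1::real" 1] by simp
qed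

lemma Cheb_T_exists:
  "\<exists>p. \<forall>\<theta>. poly p (cos \<theta>) = cos (real n * \<theta>)"
proof (induction n rule: induct_nat_012)
  case 0
  show ?case by (intro exI[of _ 1]) simp
next
  case 1
  show ?case by (intro exI[of _ "[:0, 1:]"]) simp
next
  case (ge2 n)
  then obtain p q where
    p: "\<And>\<theta>. poly p (cos \<theta>) = cos (real n * \<theta>)" and
    q: "\<And>\<theta>. poly q (cos \<theta>) = cos (real (Suc n) * \<theta>)"
    by blast
  have "cos (real (Suc (Suc n)) * \<theta>) =
      2 * cos \<theta> * cos (real (Suc n) * \<theta>) - cos (real n * \<theta>)" for \<theta> :: real
    using cos_add[of "real (Suc n) * \<theta>" \<theta>] cos_diff[of "real (Suc n) * \<theta>" \<theta>]
    by (simp add: algebra_simps)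
  then show ?case
    by (intro exI[of _ "[:0, 2:] * q - p"]) (simp add: p q mult_ac)
qed

lemma Cheb_U_exists:
  "\<exists>p. \<forall>\<theta>. sin \<theta> \<noteq> 0 \<longrightarrow> poly p (cos \<theta>) = sin ((real n + 1) * \<theta>) / sin \<theta>"
proof (induction n rule: induct_nat_012)
  case 0
  show ?case by (intro exI[of _ 1]) simp
next
  case 1
  show ?case
    by (intro exI[of _ "[:0, 2:]"]) (simp add: sin_double)
next
  case (ge2 n)
  then obtain p q where
    p: "\<And>\<theta>. sin \<theta> \<noteq> 0 \<Longrightarrow> poly p (cos \<theta>) = sin ((real n + 1) * \<theta>) / sin \<theta>" and
    q: "\<And>\<theta>. sin \<theta> \<noteq> 0 \<Longrightarrow> poly q (cos \<theta>) = sin ((real (Suc n) + 1) * \<theta>) / sin \<theta>"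
    by blast
  have "sin ((real (Suc (Suc n)) + 1) * \<theta>) =
      2 * cos \<theta> * sin ((real (Suc n) + 1) * \<theta>) - sin ((real n + 1) * \<theta>)" for \<theta> :: real
    using sin_add[of "(real (Suc n) + 1) * \<theta>" \<theta>] sin_diff[of "(real (Suc n) + 1) * \<theta>" \<theta>]
    by (simp add: algebra_simps)
  then show ?case
    by (intro exI[of _ "[:0, 2:] * q - p"]) (simp add: p q mult_ac diff_divide_distrib)
qed

lemma poly_Cheb_T_cos: "poly (Cheb_T n) (cos \<theta>) = cos (real n * \<theta>)"
proof -
  have "\<exists>!p. \<forall>\<theta>. poly p (cos \<theta>) = cos (real n * \<theta>)"
    using Cheb_T_exists[of n] by (auto intro: poly_eqI_cos)
  from theI'[OF this] show ?thesis
    unfolding Cheb_T_def by blast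
qed

lemma poly_Cheb_U_cos:
  assumes "sin \<theta> \<noteq> 0"
  shows "poly (Cheb_U n) (cos \<theta>) = sin ((real n + 1) * \<theta>) / sin \<theta>"
proof -
  have "\<exists>!p. \<forall>\<theta>. sin \<theta> \<noteq> 0 \<longrightarrow>
      poly p (cos \<theta>) = sin ((real n + 1) * \<theta>) / sin \<theta>"
    using Cheb_U_exists[of n] by (auto intro: poly_eqI_cos)
  from theI'[OF this] assms show ?thesis
    unfolding Cheb_U_def by blast
qed

end

theory Submission
  imports Defs
begin

text \<open>The polynomial \<open>(u - u\<^sub>N)'\<close> has degree at most \<open>N\<close> and vanishes at the \<open>N\<close> distinct roots of
  \<open>R = T\<^sub>N \<plusminus> T\<^bsub>N-1\<^esub>\<close>, so it equals \<open>c R\<close>; as \<open>u - u\<^sub>N\<close> vanishes at \<open>-1\<close>, it is \<open>c\<close> times the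
  primitive of \<open>R\<close> that vanishes there. The bracket is this primitive: with
  \<open>(x\<^sup>2 - 1) U\<^bsub>N-2\<^esub> = T\<^sub>N - x T\<^bsub>N-1\<^esub>\<close> it reduces to the two primitives
  \<open>((N - 1) x T\<^sub>N - N T\<^bsub>N-1\<^esub>)' = (N\<^sup>2 - 1) T\<^sub>N\<close> and
  \<open>((N - 1) T\<^sub>N - N x T\<^bsub>N-1\<^esub>)' = N (N - 2) T\<^bsub>N-1\<^esub>\<close>, combined with
  \<open>N\<^sup>3 (N - 2) + 2 N - 1 = (N\<^sup>2 - 1) (N - 1)\<^sup>2\<close>. For \<open>N = 2\<close> the second one does not yield a
  primitive of \<open>T\<^bsub>N-1\<^esub>\<close>, which is why the integral remains in the formula.\<close>

lemma Cheb_T_0: "Cheb_T 0 = 1"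
  by (rule poly_eqI_cos) (simp add: poly_Cheb_T_cos)

lemma Cheb_T_1: "Cheb_T (Suc 0) = [:0, 1:]"
  by (rule poly_eqI_cos) (simp add: poly_Cheb_T_cos)

lemma Cheb_T_rec: "Cheb_T (Suc (Suc n)) = [:0, 2:] * Cheb_T (Suc n) - Cheb_T n"
proof (rule poly_eqI_cos)
  fix \<theta> :: real
  show "poly (Cheb_T (Suc (Suc n))) (cos \<theta>) = poly ([:0, 2:] * Cheb_T (Suc n) - Cheb_T n) (cos \<theta>)"
    using cos_add[of "real (Suc n) * \<theta>" \<theta>] cos_diff[of "real (Suc n) * \<theta>" \<theta>]
    by (simp add: poly_Cheb_T_cos algebra_simps)
qed

lemma degree_Cheb_T_le: "degree (Cheb_T n) \<le> n"
proof (induction n rule: induct_nat_012)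
  case (ge2 n)
  have "degree ([:0, 2:] * Cheb_T (Suc n)) \<le> degree [:0, 2::real:] + degree (Cheb_T (Suc n))"
    by (rule degree_mult_le)
  also have "\<dots> \<le> Suc (Suc n)" using ge2 by simp
  finally show ?case
    unfolding Cheb_T_rec using ge2 by (intro degree_diff_le) auto
qed (simp_all add: Cheb_T_0 Cheb_T_1)

lemma poly_Cheb_T_minus_1: "poly (Cheb_T n) (-1) = (-1) ^ n"
  using poly_Cheb_T_cos[of n pi] by simp

text \<open>At \<open>x = cos \<theta>\<close> the factor is
  \<open>- (sin \<theta>)\<^sup>2\<close>, which cancels the denominator of \<open>Cheb_U\<close>;
  the rest is the addition formula for the cosine.\<close>

lemma Cheb_U_conv_T:
  "[:-1, 0, 1:] * Cheb_U n = Cheb_T (Suc (Suc n)) - [:0, 1:] * Cheb_T (Suc n)"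
proof (rule poly_eqI_cos)
  fix \<theta> :: real
  assume s: "sin \<theta> \<noteq> 0"
  have 1: "cos (real (Suc (Suc n)) * \<theta>)
      = cos \<theta> * cos (real (Suc n) * \<theta>) - sin \<theta> * sin ((real n + 1) * \<theta>)"
    using cos_add[of "real (Suc n) * \<theta>" \<theta>] by (simp add: algebra_simps)
  have 2: "cos \<theta> * cos \<theta> - 1 = - (sin \<theta> * sin \<theta>)"
    using sin_cos_squared_add[of \<theta>] by (simp add: power2_eq_square algebra_simps)
  have "poly ([:-1, 0, 1:] * Cheb_U n) (cos \<theta>)
      = (cos \<theta> * cos \<theta> - 1) * (sin ((real n + 1) * \<theta>) / sin \<theta>)"
    using s by (simp add: poly_Cheb_U_cos algebra_simps diff_divide_distrib)
  also have "\<dots> = - (sin \<theta> * sin ((real n + 1) * \<theta>))"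
    unfolding 2 using s by simp
  also have "\<dots> = poly (Cheb_T (Suc (Suc n)) - [:0, 1:] * Cheb_T (Suc n)) (cos \<theta>)"
    unfolding poly_diff poly_mult poly_Cheb_T_cos 1 by simp
  finally show "poly ([:-1, 0, 1:] * Cheb_U n) (cos \<theta>)
      = poly (Cheb_T (Suc (Suc n)) - [:0, 1:] * Cheb_T (Suc n)) (cos \<theta>)" .
qed

text \<open>Chain rule applied to both sides of \<open>poly_Cheb_T_cos\<close>. Keeping the factor
  \<open>sin \<theta>\<close> avoids a division.\<close>

lemma poly_pderiv_Cheb_T_cos:
  "sin \<theta> * poly (pderiv (Cheb_T n)) (cos \<theta>) = real n * sin (real n * \<theta>)"
proof -
  have "((\<lambda>\<theta>. poly (Cheb_T n) (cos \<theta>)) has_real_derivative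
      poly (pderiv (Cheb_T n)) (cos \<theta>) * (- sin \<theta>)) (at \<theta>)"
    by (rule DERIV_chain2[OF poly_DERIV]) (auto intro!: derivative_eq_intros)
  moreover have "((\<lambda>\<theta>. cos (real n * \<theta>)) has_real_derivative - sin (real n * \<theta>) * real n) (at \<theta>)"
    by (auto intro!: derivative_eq_intros)
  ultimately have "poly (pderiv (Cheb_T n)) (cos \<theta>) * (- sin \<theta>) = - sin (real n * \<theta>) * real n"
    unfolding poly_Cheb_T_cos by (rule DERIV_unique)
  then show ?thesis by (simp add: algebra_simps)
qed

text \<open>After multiplication by \<open>sin \<theta>\<close> the two derivatives turn into sines.
  Their \<open>sin a * cos \<theta>\<close> terms cancel, and \<open>cos a * sin \<theta>\<close> is
  left with coefficient n + n (n + 1) = (n + 1)^2 - 1.\<close>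

lemma pderiv_Cheb_T_Suc_primitive:
  "pderiv (smult (real n) ([:0, 1:] * Cheb_T (Suc n)) - smult (real (Suc n)) (Cheb_T n))
    = smult ((real (Suc n))\<^sup>2 - 1) (Cheb_T (Suc n))" (is "?l = ?r")
proof (rule poly_eqI_cos)
  fix \<theta> :: real
  assume s: "sin \<theta> \<noteq> 0"
  define a where "a = real (Suc n) * \<theta>"
  have b: "sin (real n * \<theta>) = sin a * cos \<theta> - cos a * sin \<theta>"
    using sin_diff[of a \<theta>] by (simp add: a_def algebra_simps)
  note d = poly_pderiv_Cheb_T_cos[of \<theta> n, unfolded b]
    poly_pderiv_Cheb_T_cos[of \<theta> "Suc n", folded a_def]
  have "sin \<theta> * poly ?l (cos \<theta>) = real n * sin \<theta> * cos a
      + real n * cos \<theta> * (sin \<theta> * poly (pderiv (Cheb_T (Suc n))) (cos \<theta>))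
      - real (Suc n) * (sin \<theta> * poly (pderiv (Cheb_T n)) (cos \<theta>))"
    by (simp add: pderiv_diff pderiv_smult pderiv_mult pderiv_pCons poly_Cheb_T_cos
        a_def algebra_simps)
  also have "\<dots> = sin \<theta> * poly ?r (cos \<theta>)"
    unfolding d poly_smult poly_Cheb_T_cos a_def[symmetric] by (simp add: algebra_simps power2_eq_square)
  finally show "poly ?l (cos \<theta>) = poly ?r (cos \<theta>)"
    using s by simp
qed

lemma pderiv_Cheb_T_primitive:
  "pderiv (smult (real n) (Cheb_T (Suc n)) - smult (real (Suc n)) ([:0, 1:] * Cheb_T n))
    = smult (real (Suc n) * (real n - 1)) (Cheb_T n)" (is "?l = ?r")
proof (rule poly_eqI_cos)
  fix \<theta> :: real
  assume s: "sin \<theta> \<noteq> 0"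
  define a where "a = real n * \<theta>"
  have b: "sin (real (Suc n) * \<theta>) = sin a * cos \<theta> + cos a * sin \<theta>"
    using sin_add[of a \<theta>] by (simp add: a_def algebra_simps)
  note d = poly_pderiv_Cheb_T_cos[of \<theta> n, folded a_def]
    poly_pderiv_Cheb_T_cos[of \<theta> "Suc n", unfolded b]
  have "sin \<theta> * poly ?l (cos \<theta>) = real n * (sin \<theta> * poly (pderiv (Cheb_T (Suc n))) (cos \<theta>))
      - real (Suc n) * sin \<theta> * cos a
      - real (Suc n) * cos \<theta> * (sin \<theta> * poly (pderiv (Cheb_T n)) (cos \<theta>))"
    by (simp add: pderiv_diff pderiv_smult pderiv_mult pderiv_pCons poly_Cheb_T_cos
        a_def algebra_simps)
  also have "\<dots> = sin \<theta> * poly ?r (cos \<theta>)"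
    unfolding d poly_smult poly_Cheb_T_cos a_def[symmetric] by (simp add: algebra_simps)
  finally show "poly ?l (cos \<theta>) = poly ?r (cos \<theta>)"
    using s by simp
qed

text \<open>Provides a primitive of \<open>Cheb_T (N - 1)\<close> for every \<open>N\<close> at
  once, so that \<open>N = 2\<close> needs no separate treatment.\<close>

lemma ex_pderiv_eq:
  fixes p :: "'a :: field_char_0 poly"
  shows "\<exists>q. pderiv q = p"
proof
  show "pderiv (\<Sum>i\<le>degree p. monom (coeff p i / of_nat (Suc i)) (Suc i)) = p"
    by (simp add: higher_pderiv_sum[of 1, simplified] pderiv_monom poly_as_sum_of_monoms
        del: of_nat_Suc)
qed

text \<open>The interval integral is oriented, so no order between \<open>a\<close> and
  \<open>b\<close> is assumed; this covers points to the left of -1.\<close>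

lemma interval_integral_poly:
  fixes p q :: "real poly"
  assumes "pderiv q = p"
  shows "(LBINT r=ereal a..ereal b. poly p r) = poly q b - poly q a"
proof (rule interval_integral_FTC_finite)
  show "continuous_on {min a b..max a b} (poly p)"
    by (intro continuous_intros)
  show "(poly q has_vector_derivative poly p r) (at r within {min a b..max a b})" for r
    using poly_DERIV[of q r] unfolding assms has_real_derivative_iff_has_vector_derivative
    by (rule has_vector_derivative_at_within)
qed

text \<open>If the coefficient at \<open>n\<close> vanishes, the degree drops below \<open>n\<close>
  and \<open>n\<close> roots force the zero polynomial. Applied to \<open>r\<close>, this shows
  \<open>coeff r n\<close> to be nonzero without computing it; applied to \<open>p\<close> minus the
  matching multiple of \<open>r\<close>, it gives the claim.\<close>

lemma poly_eq_smult_of_common_roots: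
  fixes p r :: "'a :: field poly"
  assumes "degree p \<le> n" "degree r \<le> n" "r \<noteq> 0" "finite A" "card A = n"
    and p0: "\<And>a. a \<in> A \<Longrightarrow> poly p a = 0" and r0: "\<And>a. a \<in> A \<Longrightarrow> poly r a = 0"
  shows "\<exists>c. p = smult c r"
proof -
  have zero: "q = 0" if "degree q \<le> n" "coeff q n = 0" "\<And>a. a \<in> A \<Longrightarrow> poly q a = 0"
    for q :: "'a poly"
  proof (rule ccontr)
    assume q: "q \<noteq> 0"
    have "degree q \<noteq> n" using q that(2) leading_coeff_0_iff by blast
    moreover have "card A \<le> card {a. poly q a = 0}"
      using that q by (intro card_mono poly_roots_finite) auto
    moreover have "card {a. poly q a = 0} \<le> degree q"
      using q by (rule card_poly_roots_bound)
    ultimately show False using that(1) assms by simp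
  qed
  have "coeff r n \<noteq> 0" using zero[of r] assms by blast
  then have "p - smult (coeff p n / coeff r n) r = 0"
    using assms(1,2) by (intro zero degree_diff_le degree_smult_le[THEN order_trans])
      (auto simp: p0 r0)
  then show ?thesis by auto
qed

theorem theorem3p6:
  fixes N :: nat and s :: real and u u\<^sub>N :: "real poly" and x :: "nat \<Rightarrow> real"
  assumes "N \<ge> 2"
    and "s = 1 \<or> s = -1"
    and "degree u \<le> N + 1"
    and "strict_mono_on {1..N} x"
    and "x ` {1..N} = {t. poly (Cheb_T N) t + s * poly (Cheb_T (N - 1)) t = 0}"
    and "degree u\<^sub>N \<le> N"
    and "poly u\<^sub>N (-1) = poly u (-1)"
    and "\<forall>k\<in>{1..N}. poly (pderiv u\<^sub>N) (x k) = poly (pderiv u) (x k)"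
  shows "\<exists>c::real. \<forall>t::real. poly (u - u\<^sub>N) t = c *
    (real N * (t + s) / ((real N)\<^sup>2 - 1)
        * (poly (Cheb_T N) t - s * poly (Cheb_T (N - 1)) t)
     + s * (real N * (t\<^sup>2 - 1) / (((real N)\<^sup>2 - 1) * (real N - 1)) * poly (Cheb_U (N - 2)) t)
     - (t * poly (Cheb_T N) t + (-1) ^ N) / ((real N)\<^sup>2 - 1)
     - s * ((real N)\<^sup>2 * (t * poly (Cheb_T (N - 1)) t + (-1) ^ (N - 1))
            / (((real N)\<^sup>2 - 1) * (real N - 1)\<^sup>2))
     + s * ((2 * real N - 1) / (((real N)\<^sup>2 - 1) * (real N - 1)\<^sup>2)
            * (LBINT r=ereal (-1)..ereal t. poly (Cheb_T (N - 1)) r)))"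
proof -
  obtain m where m: "N = Suc (Suc m)"
    using assms(1) by (metis Suc_le_D numeral_2_eq_2 Suc_le_mono)
  define n where "n = Suc m"
  have N: "N = Suc n" "N - 1 = n" "N - 2 = m" "real N = real n + 1"
    and n: "real n > 0"
    using m by (auto simp: n_def)
  have D: "(real N)\<^sup>2 - 1 = real n * (real n + 2)"
    by (simp add: N power2_eq_square algebra_simps)
  define R where "R = Cheb_T N + smult s (Cheb_T n)"
  have roots: "x ` {1..N} = {t. poly R t = 0}"
    using assms(5) by (simp add: R_def N)
  have "\<exists>c. pderiv (u - u\<^sub>N) = smult c R"
  proof (rule poly_eq_smult_of_common_roots)
    show "degree R \<le> N"
      using degree_Cheb_T_le[of N] degree_Cheb_T_le[of n] unfolding R_def
      by (intro degree_add_le degree_smult_le[THEN order_trans]) (auto simp: N)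
    \<comment> \<open>Otherwise every real number would be a root, but the root set is the image of
      a finite set.\<close>
    show "R \<noteq> 0"
      using roots infinite_UNIV_char_0[where 'a = real] finite_imageI[of "{1..N}" x] by auto
    show "degree (pderiv (u - u\<^sub>N)) \<le> N"
      using degree_diff_le[of u "N + 1" u\<^sub>N] assms(3,6) by (simp add: degree_pderiv)
    show "card (x ` {1..N}) = N"
      using strict_mono_on_imp_inj_on[OF assms(4)] by (simp add: card_image)
    show "poly (pderiv (u - u\<^sub>N)) a = 0" if "a \<in> x ` {1..N}" for a
      using that assms(8) by (auto simp: pderiv_diff)
    show "poly R a = 0" if "a \<in> x ` {1..N}" for a
      using that unfolding roots by simp
  qed simp
  then obtain c where c: "pderiv (u - u\<^sub>N) = smult c R" ..
  obtain G where G: "pderiv G = Cheb_T n"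
    using ex_pderiv_eq by blast
  define P where "P = smult (real n) ([:0, 1:] * Cheb_T N) - smult (real N) (Cheb_T n)"
  define Q where "Q = smult (real n) (Cheb_T N) - smult (real N) ([:0, 1:] * Cheb_T n)"
  \<comment> \<open>A primitive of \<open>R\<close>, not yet normalised at -1. The weight
    \<open>2 * real N - 1\<close> of \<open>G\<close> tops up the multiple of
    \<open>Cheb_T n\<close> coming from \<open>Q\<close>, as computed in
    \<open>coeff\<close>.\<close>
  define F where "F = smult (1 / ((real N)\<^sup>2 - 1))
    (P + smult (s / (real n)\<^sup>2) (smult ((real N)\<^sup>2) Q + smult (2 * real N - 1) G))"
  have dP: "pderiv P = smult ((real N)\<^sup>2 - 1) (Cheb_T N)"
    unfolding P_def N(1) by (rule pderiv_Cheb_T_Suc_primitive)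
  have dQ: "pderiv Q = smult (real N * (real n - 1)) (Cheb_T n)"
    unfolding Q_def N(1) by (rule pderiv_Cheb_T_primitive)
  have coeff: "(real N)\<^sup>2 * (real N * (real n - 1)) + (2 * real N - 1)
      = ((real N)\<^sup>2 - 1) * (real n)\<^sup>2"
    by (simp add: N power2_eq_square algebra_simps)
  have "pderiv F = smult (1 / ((real N)\<^sup>2 - 1)) (smult ((real N)\<^sup>2 - 1) (Cheb_T N) +
      smult (s / (real n)\<^sup>2) (smult ((real N)\<^sup>2 * (real N * (real n - 1)) + (2 * real N - 1))
        (Cheb_T n)))"
    by (simp add: F_def pderiv_smult pderiv_add dP dQ G smult_add_left del: of_nat_Suc)
  also have "\<dots> = R"
    unfolding coeff R_def smult_add_right smult_smult using n D by simp
  finally have "pderiv (u - u\<^sub>N - smult c F) = 0"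
    by (simp add: pderiv_diff pderiv_smult flip: c)
  then obtain h where h: "u - u\<^sub>N - smult c F = [:h:]"
    using pderiv_iszero by blast
  \<comment> \<open>Since \<open>u\<close> and \<open>u\<^sub>N\<close> agree at -1, evaluation
    there determines \<open>h\<close>.\<close>
  have u: "poly (u - u\<^sub>N) t = c * (poly F t - poly F (-1))" for t
    using arg_cong[OF h, of "\<lambda>p. poly p t"] arg_cong[OF h, of "\<lambda>p. poly p (-1)"] assms(7)
    by (simp add: algebra_simps)
  show ?thesis
  proof (intro exI allI)
    fix t :: real
    define a b g e where "a = poly (Cheb_T N) t" "b = poly (Cheb_T n) t"
      "g = poly G t - poly G (-1)" "e = (-1 :: real) ^ n"
    have U: "(t\<^sup>2 - 1) * poly (Cheb_U m) t = a - t * b"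
      using arg_cong[OF Cheb_U_conv_T[of m], of "\<lambda>p. poly p t"]
      by (simp add: a_b_g_e_def m n_def power2_eq_square algebra_simps)
    have U': "real N * (t\<^sup>2 - 1) / (d :: real) * poly (Cheb_U m) t = real N * (a - t * b) / d" for d
      by (simp flip: U)
    have M: "real N - 1 = real n" "(-1) ^ N = - e"
      by (simp_all add: N a_b_g_e_def)
    \<comment> \<open>At -1 the values of \<open>P\<close> and \<open>Q\<close> collapse to
      \<open>- e\<close> and \<open>e\<close>, because \<open>N\<close> and \<open>n\<close> differ
      by one.\<close>
    have P: "poly P t - poly P (-1) = real n * t * a - real N * b + e"
      by (simp add: P_def a_b_g_e_def poly_Cheb_T_minus_1 N(1) algebra_simps)
    have Q: "poly Q t - poly Q (-1) = real n * a - real N * t * b - e"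
      by (simp add: Q_def a_b_g_e_def poly_Cheb_T_minus_1 N(1) algebra_simps)
    have "poly F t - poly F (-1) = 1 / ((real N)\<^sup>2 - 1) * ((poly P t - poly P (-1)) + s / (real n)\<^sup>2 *
        ((real N)\<^sup>2 * (poly Q t - poly Q (-1)) + (2 * real N - 1) * g))"
      by (simp add: F_def a_b_g_e_def) (simp add: algebra_simps add_divide_distrib diff_divide_distrib)
    \<comment> \<open>As s^2 = 1, the product (t + s) (a - s b) is t a - b + s (a - t b). Its last
      part joins the \<open>Cheb_U\<close> term to give s N^2 (a - t b) / n, which together with the
      t b + e term is the contribution of \<open>Q\<close>.\<close>
    also have "\<dots> = real N * (t + s) / ((real N)\<^sup>2 - 1) * (a - s * b)
        + s * (real N * (a - t * b) / (((real N)\<^sup>2 - 1) * real n))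
        - (t * a + - e) / ((real N)\<^sup>2 - 1)
        - s * ((real N)\<^sup>2 * (t * b + e) / (((real N)\<^sup>2 - 1) * (real n)\<^sup>2))
        + s * ((2 * real N - 1) / (((real N)\<^sup>2 - 1) * (real n)\<^sup>2) * g)"
      using assms(2) n unfolding P Q D unfolding N(4)
      by (elim disjE) (simp_all add: divide_simps, simp_all add: algebra_simps power2_eq_square)
    finally have "poly (u - u\<^sub>N) t = c * \<dots>"
      by (simp only: u)
    then show "poly (u - u\<^sub>N) t = c *
    (real N * (t + s) / ((real N)\<^sup>2 - 1)
        * (poly (Cheb_T N) t - s * poly (Cheb_T (N - 1)) t)
     + s * (real N * (t\<^sup>2 - 1) / (((real N)\<^sup>2 - 1) * (real N - 1)) * poly (Cheb_U (N - 2)) t)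
     - (t * poly (Cheb_T N) t + (-1) ^ N) / ((real N)\<^sup>2 - 1)
     - s * ((real N)\<^sup>2 * (t * poly (Cheb_T (N - 1)) t + (-1) ^ (N - 1))
            / (((real N)\<^sup>2 - 1) * (real N - 1)\<^sup>2))
     + s * ((2 * real N - 1) / (((real N)\<^sup>2 - 1) * (real N - 1)\<^sup>2)
            * (LBINT r=ereal (-1)..ereal t. poly (Cheb_T (N - 1)) r)))"
      unfolding M N(2,3) U' interval_integral_poly[OF G] a_b_g_e_def .
  qed
qed

end
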